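(* Let $a,b\in\mathbb{C}$ with $|a|^2+|b|^2=1$, let $x,y\ge 1$ be integers, let $|\eta\rangle=a|00\rangle+b|11\rangle$, and let $|\xi\rangle=a|0\rangle^{\otimes (y+1)}+b|1\rangle^{\otimes (y+1)}$. Then $$S^{\otimes x}\Big\{|\eta\rangle^{\otimes x}\otimes\big[S_y|\eta\rangle^{\otimes(y+1)}\big]\Big\}=S^{\otimes(x+y)}\Big(|\eta\rangle^{\otimes(x+y)}\otimes|\xi\rangle\Big),$$ in the sense that both sides are random $(y+1)$-qubit states taking each value $|\xi_k\rangle$, $k\ge0$, with the same probability. That is, performing a star swap on $y+1$ pairs followed by $x$ successive linear swaps gives the same output distribution as $x+y$ successive linear swaps starting from $|\xi\rangle$.
   Context: For $m\in\{0,1,2,\dots\}$ put $n_m=\sqrt{|a|^{2m}+|b|^{2m}}$ (with $0^0=1$), $|\eta_m\rangle=\frac{a^m|00\rangle+b^m|11\rangle}{n_m}$ and, on $j=y+1$ qubits, $|\xi_m\rangle=\frac{a^m|0\rangle^{\otimes j}+b^m|1\rangle^{\otimes j}}{n_m}$. States are identified when they agree up to a global phase and up to the simultaneous bit flip $X^{\otimes j}$. All measurement outcomes below are not recorded, so outputs are random pure states described by listing states with probabilities; labels are formal, i.e. the probability attached to $|\xi_k\rangle$ is the total probability of the outcomes giving index $k$, as specified below. Linear swap $S$ between a $j$-qubit state $|\xi_m\rangle$ (qubits $1,\dots,j$) and $|\eta_p\rangle$ (qubits $j+1,j+2$): apply CNOT with control qubit $j$ and target qubit $j+1$; apply a Hadamard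 gate to qubit $j$; measure qubits $j,j+1$ in the computational basis with outcomes $s,t$; apply $Z^s$ to qubit $j-1$ and $X^t$ to qubit $j+2$; output the state of qubits $1,\dots,j-1,j+2$. Outcome $t=0$ gives index $m+p$, and $t=1$ gives index $|m-p|$. (By symmetry any of the $j$ qubits may play the role of qubit $j$.) $S^{\otimes x}(|\eta\rangle^{\otimes x}\otimes|\Xi\rangle)$, for a (possibly random) $j$-qubit state $|\Xi\rangle$ with values among the $|\xi_m\rangle$, denotes $x$ successive swaps of the current state with fresh copies of $|\eta\rangle=|\eta_1\rangle$, with independent measurement randomness. Star swap $S_y$ on $|\eta\rangle^{\otimes(y+1)}$: pair $i$ ($i=1,\dots,y+1$) consists of a peripheral qubit $q_i$ and a central qubit $c_i$; apply CNOT gates with control $c_1$ and target $c_i$ for every $i\ge2$; apply a Hadamard gate to $c_1$; measure all $c_i$ in the computational basis with outcomes $t_i$; apply $Z^{t_1}$ to $q_1$ and $X^{t_i}$ to $q_i$ for $i\ge2$; output the state of $q_1,\dots,q_{y+1}$. Outcomes with $o=t_2+\dots+t_{y+1}$ give index $|y+1-2o|$. *)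

theory Defs
  imports "HOL-Probability.Probability_Mass_Function"
begin

section \<open>Pure states of a finite register of qubits\<close>

text \<open>
  The computational basis vector in which exactly the qubits of a set \<open>A\<close> have value 1 is
  identified with \<open>A\<close>.  A state of the finite register \<open>Q\<close> is given by its amplitudes, a function
  on sets of qubits that vanishes outside \<open>Pow Q\<close>.
\<close>

type_synonym 'q state = "'q set \<Rightarrow> complex"

text \<open>The vector \<open>\<alpha> |0...0> + \<beta> |1...1>\<close> on a nonempty register \<open>Q\<close>.\<close>

definition cat_state :: "'q set \<Rightarrow> complex \<Rightarrow> complex \<Rightarrow> 'q state" where
  "cat_state Q \<alpha> \<beta> = (\<lambda>A. if A = {} then \<alpha> else if A = Q then \<beta> else 0)"

definition tensor :: "'q set \<Rightarrow> 'q set \<Rightarrow> 'q state \<Rightarrow> 'q state \<Rightarrow> 'q state" where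
  "tensor P Q \<phi> \<psi> = (\<lambda>A. if A \<subseteq> P \<union> Q then \<phi> (A \<inter> P) * \<psi> (A \<inter> Q) else 0)"

definition tensor_family :: "'i set \<Rightarrow> ('i \<Rightarrow> 'q set) \<Rightarrow> ('i \<Rightarrow> 'q state) \<Rightarrow> 'q state" where
  "tensor_family I Q \<psi> =
     (\<lambda>A. if A \<subseteq> (\<Union>i\<in>I. Q i) then \<Prod>i\<in>I. \<psi> i (A \<inter> Q i) else 0)"

text \<open>Renaming of qubits: \<open>f\<close> maps the new register \<open>Q\<close> bijectively onto the old one.\<close>

definition rename :: "('p \<Rightarrow> 'q) \<Rightarrow> 'p set \<Rightarrow> 'q state \<Rightarrow> 'p state" where
  "rename f Q \<psi> = (\<lambda>A. if A \<subseteq> Q then \<psi> (f ` A) else 0)"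

section \<open>Gates\<close>

definition cnot :: "'q \<Rightarrow> 'q \<Rightarrow> 'q state \<Rightarrow> 'q state" where
  "cnot c t \<psi> =
     (\<lambda>A. \<psi> (if c \<in> A then (if t \<in> A then A - {t} else insert t A) else A))"

definition hadamard :: "'q \<Rightarrow> 'q state \<Rightarrow> 'q state" where
  "hadamard q \<psi> =
     (\<lambda>A. (\<psi> (A - {q}) + (if q \<in> A then - 1 else 1) * \<psi> (insert q A)) / complex_of_real (sqrt 2))"

definition pauli_Z :: "'q \<Rightarrow> 'q state \<Rightarrow> 'q state" where
  "pauli_Z q \<psi> = (\<lambda>A. (if q \<in> A then - 1 else 1) * \<psi> A)"

text \<open>\<open>pauli_X F\<close> applies a bit flip simultaneously to every qubit of \<open>F\<close>.\<close>

definition pauli_X :: "'q set \<Rightarrow> 'q state \<Rightarrow> 'q state" where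
  "pauli_X F \<psi> = (\<lambda>A. \<psi> ((A - F) \<union> (F - A)))"

section \<open>Measurement in the computational basis\<close>

text \<open>
  When the qubits \<open>M\<close> of the register \<open>Q\<close> are measured, the outcome \<open>T \<subseteq> M\<close> is the set of
  qubits for which the result is 1.  The remaining register is \<open>Q - M\<close>.
\<close>

definition born :: "'q set \<Rightarrow> 'q set \<Rightarrow> 'q state \<Rightarrow> 'q set \<Rightarrow> real" where
  "born Q M \<psi> T = (if T \<subseteq> M then \<Sum>B\<in>Pow (Q - M). (cmod (\<psi> (B \<union> T)))\<^sup>2 else 0)"

definition collapse :: "'q set \<Rightarrow> 'q set \<Rightarrow> 'q state \<Rightarrow> 'q set \<Rightarrow> 'q state" where
  "collapse Q M \<psi> T =
     (\<lambda>B. if B \<subseteq> Q - M then \<psi> (B \<union> T) / complex_of_real (sqrt (born Q M \<psi> T)) else 0)"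

text \<open>For a unit vector \<open>\<psi>\<close> on a finite register the Born weights sum to 1, as \<open>embed_pmf\<close> requires.\<close>

definition measurement :: "'q set \<Rightarrow> 'q set \<Rightarrow> 'q state \<Rightarrow> ('q set \<times> 'q state) pmf" where
  "measurement Q M \<psi> = map_pmf (\<lambda>T. (T, collapse Q M \<psi> T)) (embed_pmf (born Q M \<psi>))"

section \<open>The states \<open>\<xi>\<^sub>m\<close> and the identification of states\<close>

definition state_equiv :: "'q set \<Rightarrow> 'q state \<Rightarrow> 'q state \<Rightarrow> bool" where
  "state_equiv Q \<phi> \<psi> \<longleftrightarrow>
     (\<exists>c. cmod c = 1 \<and> ((\<forall>A. \<phi> A = c * \<psi> A) \<or> (\<forall>A. \<phi> A = c * pauli_X Q \<psi> A)))"

definition xi :: "complex \<Rightarrow> complex \<Rightarrow> 'q set \<Rightarrow> nat \<Rightarrow> 'q state" where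
  "xi a b Q m =
     (let n = complex_of_real (sqrt (cmod a ^ (2 * m) + cmod b ^ (2 * m)))
      in cat_state Q (a ^ m / n) (b ^ m / n))"

text \<open>
  A random state is a distribution on pairs of a formal index and a state.  The rules that give the
  new index after a linear swap refer to the representative \<open>\<xi>\<^sub>m\<close> of the current state: on
  \<open>X \<dots> X \<xi>\<^sub>m\<close> the two outcomes \<open>t\<close> exchange their roles.  So a state that is identified with
  \<open>\<xi>\<^sub>m\<close> is replaced by \<open>\<xi>\<^sub>m\<close> before the next swap.
\<close>

type_synonym 'q random_state = "(nat \<times> 'q state) pmf"

definition representative :: "complex \<Rightarrow> complex \<Rightarrow> 'q set \<Rightarrow> nat \<Rightarrow> 'q state \<Rightarrow> 'q state" where
  "representative a b Q m \<psi> = (if state_equiv Q \<psi> (xi a b Q m) then xi a b Q m else \<psi>)"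

definition values_in_xi :: "complex \<Rightarrow> complex \<Rightarrow> 'q set \<Rightarrow> 'q random_state \<Rightarrow> bool" where
  "values_in_xi a b Q \<Xi> \<longleftrightarrow> (\<forall>(k, \<psi>) \<in> set_pmf \<Xi>. state_equiv Q \<psi> (xi a b Q k))"

section \<open>Linear swap\<close>

text \<open>
  The \<open>j\<close>-qubit state \<open>\<psi>\<close> (index \<open>m\<close>) lives on \<open>{1..j}\<close> and the two-qubit state \<open>\<eta>\<close>
  (index \<open>p\<close>) on \<open>{j + 1, j + 2}\<close>.  In the output, qubit \<open>j + 2\<close> is renamed to \<open>j\<close>.
\<close>

definition linear_swap ::
    "nat \<Rightarrow> nat \<times> nat state \<Rightarrow> nat \<times> nat state \<Rightarrow> nat random_state" where
  "linear_swap j = (\<lambda>(m, \<psi>) (p, \<eta>).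
     map_pmf
       (\<lambda>(T, \<phi>).
          (if j + 1 \<in> T then nat \<bar>int m - int p\<bar> else m + p,
           rename (\<lambda>q. if q = j then j + 2 else q) {1..j}
             (pauli_X (if j + 1 \<in> T then {j + 2} else {})
               (if j \<in> T then pauli_Z (j - 1) \<phi> else \<phi>))))
       (measurement {1..j + 2} {j, j + 1}
          (hadamard j (cnot j (j + 1) (tensor {1..j} {j + 1, j + 2} \<psi> \<eta>)))))"

definition swap_step :: "complex \<Rightarrow> complex \<Rightarrow> nat \<Rightarrow> nat random_state \<Rightarrow> nat random_state" where
  "swap_step a b j \<Xi> =
     bind_pmf \<Xi> (\<lambda>(m, \<psi>).
       linear_swap j (m, representative a b {1..j} m \<psi>) (1, cat_state {j + 1, j + 2} a b))"

definition swaps :: "complex \<Rightarrow> complex \<Rightarrow> nat \<Rightarrow> nat \<Rightarrow> nat random_state \<Rightarrow> nat random_state" where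
  "swaps a b j x = swap_step a b j ^^ x"

section \<open>Star swap\<close>

datatype star_qubit = Peripheral nat | Central nat

definition star_swap :: "complex \<Rightarrow> complex \<Rightarrow> nat \<Rightarrow> nat random_state" where
  "star_swap a b y =
     (let pair = (\<lambda>i. {Peripheral i, Central i});
          Q = (\<Union>i\<in>{1..y + 1}. pair i);
          \<Psi> = tensor_family {1..y + 1} pair (\<lambda>i. cat_state (pair i) a b);
          \<Psi>' = fold (\<lambda>i. cnot (Central 1) (Central i)) [2..<y + 2] \<Psi>
      in map_pmf
           (\<lambda>(T, \<phi>).
              (nat \<bar>int (y + 1) - 2 * int (card {i \<in> {2..y + 1}. Central i \<in> T})\<bar>,
               rename Peripheral {1..y + 1}
                 (pauli_X {Peripheral i | i. i \<in> {2..y + 1} \<and> Central i \<in> T}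
                   (if Central 1 \<in> T then pauli_Z (Peripheral 1) \<phi> else \<phi>))))
           (measurement Q (Central ` {1..y + 1}) (hadamard (Central 1) \<Psi>')))"

end

theory Submission
  imports Defs
begin

text \<open>
  The index of the linear swaps is a Markov chain on the naturals whose transition probabilities
  depend only on \<open>\<bar>a\<bar>\<^sup>2\<close>.  After unfolding the reflection at 0, the walk started at 1 has after \<open>y\<close>
  steps the value \<open>y + 1 - 2 i\<close>, where \<open>i\<close> counts the downward steps, and every path with \<open>i\<close> such steps
  has the same weight \<open>\<bar>a\<^sup>n\<^sup>-\<^sup>i b\<^sup>i\<bar>\<^sup>2 + \<bar>a\<^sup>i b\<^sup>n\<^sup>-\<^sup>i\<bar>\<^sup>2\<close> with \<open>n = y + 1\<close>.  This is also the total Born weight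
  of a pattern of \<open>i\<close> ones on the targets of a star swap, so a star swap is worth \<open>y\<close> linear swaps.
\<close>

section \<open>The random index\<close>

lemma pmf_map_finite_support:
  assumes "finite S" "set_pmf \<mu> \<subseteq> S"
  shows "pmf (map_pmf f \<mu>) k = (\<Sum>x\<in>S. if f x = k then pmf \<mu> x else 0)"
proof -
  have "pmf (map_pmf f \<mu>) k = measure \<mu> {x\<in>S. f x = k}"
    unfolding pmf_map using assms(2)
    by (intro measure_pmf.finite_measure_eq_AE) (auto simp: AE_measure_pmf_iff)
  also have "\<dots> = (\<Sum>x\<in>{x\<in>S. f x = k}. pmf \<mu> x)"
    using assms(1) by (intro measure_measure_pmf_finite) auto
  finally show ?thesis
    using assms(1) by (simp add: sum.inter_filter)
qed

lemma sum_Pow_card: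
  fixes g :: "nat \<Rightarrow> real"
  assumes "finite M"
  shows "(\<Sum>T\<in>Pow M. g (card T)) = (\<Sum>k\<le>card M. (card M choose k) * g k)"
proof -
  have "(\<Sum>T\<in>Pow M. g (card T)) = (\<Sum>k\<le>card M. \<Sum>T\<in>{T\<in>Pow M. card T = k}. g (card T))"
    using assms by (intro sum.group[symmetric]) (auto intro: card_mono)
  also have "\<dots> = (\<Sum>k\<le>card M. (card M choose k) * g k)"
  proof (rule sum.cong)
    fix k
    have "card {T\<in>Pow M. card T = k} = card M choose k"
      using n_subsets[OF assms, of k] by simp
    then show "(\<Sum>T\<in>{T\<in>Pow M. card T = k}. g (card T)) = (card M choose k) * g k"
      by simp
  qed simp
  finally show ?thesis .
qed

text \<open>The summand ignores \<open>c\<close>, so \<open>T\<close> and \<open>insert c T\<close>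
  contribute equally. In the measurements \<open>c\<close> is the Hadamard qubit, whose outcome
  affects neither the index nor the Born weight.\<close>

lemma sum_Pow_insert_card:
  fixes g :: "nat \<Rightarrow> real"
  assumes "finite M" "c \<notin> M"
  shows "(\<Sum>T\<in>Pow (insert c M). g (card (T - {c}))) = 2 * (\<Sum>k\<le>card M. (card M choose k) * g k)"
proof -
  have "(\<Sum>T\<in>Pow (insert c M). g (card (T - {c})))
      = (\<Sum>T\<in>Pow M. g (card (T - {c}))) + (\<Sum>T\<in>insert c ` Pow M. g (card (T - {c})))"
    unfolding Pow_insert using assms by (intro sum.union_disjoint) auto
  also have "(\<Sum>T\<in>insert c ` Pow M. g (card (T - {c}))) = (\<Sum>T\<in>Pow M. g (card (insert c T - {c})))"
    using assms by (subst sum.reindex) (auto simp: inj_on_def insert_ident)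
  also have "(\<Sum>T\<in>Pow M. g (card (insert c T - {c}))) = (\<Sum>T\<in>Pow M. g (card T))"
    using assms(2) by (intro sum.cong refl arg_cong[of _ _ "\<lambda>T. g (card T)"]) auto
  also have "(\<Sum>T\<in>Pow M. g (card (T - {c}))) = (\<Sum>T\<in>Pow M. g (card T))"
    using assms(2) by (intro sum.cong refl arg_cong[of _ _ "\<lambda>T. g (card T)"]) auto
  finally show ?thesis
    using sum_Pow_card[OF assms(1), of g] by simp
qed

text \<open>
  The number \<open>o\<close> of ones among the outcomes of the central qubits \<open>2, \<dots>, y + 1\<close> is a mixture of
  two binomial variables, with weights \<open>\<bar>a\<bar>\<^sup>2 = A\<close> and \<open>\<bar>b\<bar>\<^sup>2 = 1 - A\<close>.
\<close>

definition star_outcomes :: "real \<Rightarrow> nat \<Rightarrow> nat pmf" where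
  "star_outcomes A y =
     bind_pmf (bernoulli_pmf A) (\<lambda>c. binomial_pmf y (if c then 1 - A else A))"

text \<open>The mixing weight raises one exponent of the binomial weight by 1, so both monomials
  have degree \<open>y + 1\<close>, the number of pairs in the star.\<close>

lemma pmf_star_outcomes:
  fixes A :: real
  assumes "0 \<le> A" "A \<le> 1" "k \<le> y"
  shows "pmf (star_outcomes A y) k =
    real (y choose k) * (A ^ (y + 1 - k) * (1 - A) ^ k + A ^ k * (1 - A) ^ (y + 1 - k))"
  using assms by (simp add: star_outcomes_def pmf_bind Suc_diff_le algebra_simps)

lemma pmf_star_outcomes_eq_0:
  fixes A :: real
  assumes "0 \<le> A" "A \<le> 1" "k > y"
  shows "pmf (star_outcomes A y) k = 0"
  using assms by (simp add: star_outcomes_def pmf_bind binomial_eq_0)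

lemma set_star_outcomes:
  fixes A :: real
  assumes "0 \<le> A" "A \<le> 1"
  shows "set_pmf (star_outcomes A y) \<subseteq> {..y}"
  using pmf_star_outcomes_eq_0[OF assms] by (force simp: set_pmf_iff not_le[symmetric])

lemma star_outcomes_0:
  fixes A :: real
  assumes "0 \<le> A" "A \<le> 1"
  shows "star_outcomes A 0 = return_pmf 0"
  using set_star_outcomes[OF assms, of 0] set_pmf_not_empty[of "star_outcomes A 0"]
  by (subst set_pmf_subset_singleton[symmetric]) auto

section \<open>Transition probabilities of the number of ones\<close>

lemma weighted_mean_bounds:
  fixes U V A :: real
  assumes "0 \<le> A" "A \<le> 1" "0 \<le> U" "0 \<le> V"
  shows "0 \<le> (U * (1 - A) + V * A) / (U + V)" "(U * (1 - A) + V * A) / (U + V) \<le> 1"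
proof -
  show "0 \<le> (U * (1 - A) + V * A) / (U + V)"
    using assms by simp
  have "U * (1 - A) + V * A \<le> U * 1 + V * 1"
    using assms by (intro add_mono mult_left_mono) auto
  then show "(U * (1 - A) + V * A) / (U + V) \<le> 1"
    \<comment> \<open>For \<open>U + V = 0\<close> the quotient is 0 by the convention for
      division.\<close>
    using assms by (cases "U + V = 0") (auto simp: divide_simps)
qed

lemma pmf_map_add_bernoulli:
  fixes p :: real
  assumes "0 \<le> p" "p \<le> 1"
  shows "pmf (map_pmf (\<lambda>t. i + of_bool t) (bernoulli_pmf p)) (k::nat) =
    (if k = i + 1 then p else 0) + (if k = i then 1 - p else 0)"
  using assms by (subst pmf_map_finite_support[where S = UNIV]) (auto simp: UNIV_bool)

lemma sum_bernoulli_step: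
  fixes d p :: "nat \<Rightarrow> real"
  shows "(\<Sum>i\<le>y. ((if k = i + 1 then p i else 0) + (if k = i then 1 - p i else 0)) * d i) =
    (if 1 \<le> k \<and> k \<le> y + 1 then d (k - 1) * p (k - 1) else 0) + (if k \<le> y then d k * (1 - p k) else 0)"
proof -
  have "(\<Sum>i\<le>y. ((if k = i + 1 then p i else 0) + (if k = i then 1 - p i else 0)) * d i) =
      (\<Sum>i\<le>y. if k - 1 = i then (if k \<ge> 1 then d i * p i else 0) else 0) +
      (\<Sum>i\<le>y. if k = i then d i * (1 - p i) else 0)"
    unfolding sum.distrib[symmetric] by (intro sum.cong) auto
  also have "\<dots> = (if 1 \<le> k \<and> k \<le> y + 1 then d (k - 1) * p (k - 1) else 0) +
      (if k \<le> y then d k * (1 - p k) else 0)"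
    by (subst (1 2) sum.delta') auto
  finally show ?thesis .
qed

text \<open>A mixture of binomials grows one trial at a time. After \<open>i\<close> ones in
  \<open>y\<close> trials the two components have posterior weights proportional to
  \<open>U y i\<close> and \<open>V y i\<close>, and the next trial succeeds with the posterior mean
  of \<open>1 - A\<close> and \<open>A\<close>.\<close>

lemma star_outcomes_Suc:
  fixes A :: real
  assumes A: "0 \<le> A" "A \<le> 1"
  defines "U \<equiv> \<lambda>y i. A ^ (y + 1 - i) * (1 - A) ^ i" and "V \<equiv> \<lambda>y i. A ^ i * (1 - A) ^ (y + 1 - i)"
  shows "star_outcomes A (Suc y) =
    bind_pmf (star_outcomes A y) (\<lambda>i. map_pmf (\<lambda>t. i + of_bool t)
      (bernoulli_pmf ((U y i * (1 - A) + V y i * A) / (U y i + V y i))))"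
    (is "_ = bind_pmf _ (\<lambda>i. map_pmf _ (bernoulli_pmf (?p i)))")
proof (rule pmf_eqI)
  fix k
  let ?D = "pmf (star_outcomes A y)"
  have UV: "U y i \<ge> 0" "V y i \<ge> 0" for i
    using A by (auto simp: U_def V_def)
  have D: "?D i = (y choose i) * (U y i + V y i)" if "i \<le> y" for i
    using pmf_star_outcomes[OF A that] by (simp add: U_def V_def)
  \<comment> \<open>The mass of \<open>i\<close> cancels the denominator of the conditional
    probability; if \<open>U y i + V y i = 0\<close>, both terms vanish and so do both
    sides.\<close>
  have p: "?D i * ?p i = (y choose i) * (U y i * (1 - A) + V y i * A)" if "i \<le> y" for i
    using D[OF that] UV[of i] by (cases "U y i + V y i = 0") (auto simp: add_nonneg_eq_0_iff)
  have q: "?D i * (1 - ?p i) = (y choose i) * (U y i * A + V y i * (1 - A))" if "i \<le> y" for i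
    using p[OF that] D[OF that] by (simp add: algebra_simps)
  have "pmf (bind_pmf (star_outcomes A y) (\<lambda>i. map_pmf (\<lambda>t. i + of_bool t) (bernoulli_pmf (?p i)))) k
      = (\<Sum>i\<le>y. ((if k = i + 1 then ?p i else 0) + (if k = i then 1 - ?p i else 0)) * ?D i)"
    unfolding pmf_bind using set_star_outcomes[OF A] weighted_mean_bounds[OF A UV]
    by (subst integral_measure_pmf_real[where A = "{..y}"]) (auto simp: pmf_map_add_bernoulli)
  also have "\<dots> = (if 1 \<le> k \<and> k \<le> y + 1 then ?D (k - 1) * ?p (k - 1) else 0)
      + (if k \<le> y then ?D k * (1 - ?p k) else 0)"
    by (rule sum_bernoulli_step)
  also have "(if 1 \<le> k \<and> k \<le> y + 1 then ?D (k - 1) * ?p (k - 1) else 0)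
      + (if k \<le> y then ?D k * (1 - ?p k) else 0) = pmf (star_outcomes A (Suc y)) k"
  proof -
    define B where "B = 1 - A"
    have pmf_Suc: "pmf (star_outcomes A (Suc y)) k =
        (Suc y choose k) * (A ^ (Suc y + 1 - k) * B ^ k + A ^ k * B ^ (Suc y + 1 - k))" if "k \<le> Suc y"
      using pmf_star_outcomes[OF A that] by (simp only: B_def)
    have p: "?D i * ?p i =
        (y choose i) * (A ^ (y + 1 - i) * B ^ i * B + A ^ i * B ^ (y + 1 - i) * A)" if "i \<le> y" for i
      using p[OF that] unfolding U_def V_def B_def .
    have q: "?D i * (1 - ?p i) =
        (y choose i) * (A ^ (y + 1 - i) * B ^ i * A + A ^ i * B ^ (y + 1 - i) * B)" if "i \<le> y" for i
      using q[OF that] unfolding U_def V_def B_def .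
    \<comment> \<open>The extreme values \<open>0\<close> and \<open>Suc y\<close> have a single
      predecessor; every value between them has two.\<close>
    consider "k = 0" | "k \<ge> 1" "k \<le> y" | "k = Suc y" | "k > Suc y"
      by linarith
    then show ?thesis
    proof cases
      case 1
      then show ?thesis
        using pmf_Suc q[of 0] by (simp add: mult.commute)
    next
      case 2
      then obtain i where i: "k = Suc i" "i \<le> y"
        by (cases k) auto
      define d where "d = y - i"
      have "y + 1 - i = Suc d" "Suc y + 1 - k = Suc d" "y + 1 - k = d"
        using 2 i by (auto simp: d_def)
      note eqs = this
      have "?D i * ?p i + ?D k * (1 - ?p k) =
          (y choose i) * (A ^ Suc d * B ^ i * B + A ^ i * B ^ Suc d * A) +
          (y choose k) * (A ^ d * B ^ k * A + A ^ k * B ^ d * B)"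
        unfolding p[OF \<open>i \<le> y\<close>] q[OF \<open>k \<le> y\<close>] eqs ..
      \<comment> \<open>Both brackets equal the bracket on the right, so Pascal's rule adds the
        coefficients.\<close>
      also have "\<dots> = (Suc y choose k) * (A ^ Suc d * B ^ k + A ^ k * B ^ Suc d)"
        by (simp add: i algebra_simps)
      finally show ?thesis
        using 2 pmf_Suc eqs i by simp
    next
      case 3
      then show ?thesis
        using pmf_Suc p[of y] by (simp add: mult.commute)
    next
      case 4
      then show ?thesis using pmf_star_outcomes_eq_0[OF A, of "Suc y" k] by auto
    qed
  qed
  finally show "pmf (star_outcomes A (Suc y)) k =
      pmf (bind_pmf (star_outcomes A y) (\<lambda>i. map_pmf (\<lambda>t. i + of_bool t) (bernoulli_pmf (?p i)))) k"
    by simp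
qed

text \<open>The parameter is the Born probability of \<open>t = 1\<close> for a linear swap of the
  state with index \<open>m\<close>, where \<open>A\<close> stands for the squared modulus of
  \<open>a\<close>. At \<open>m = 0\<close> both outcomes lead to 1, which is the
  reflection.\<close>

definition index_step :: "real \<Rightarrow> nat \<Rightarrow> nat pmf" where
  "index_step A m = map_pmf (\<lambda>t. if t then nat \<bar>int m - 1\<bar> else m + 1)
     (bernoulli_pmf ((A ^ m * (1 - A) + (1 - A) ^ m * A) / (A ^ m + (1 - A) ^ m)))"

definition star_index :: "nat \<Rightarrow> nat \<Rightarrow> nat" where
  "star_index y i = nat \<bar>int (y + 1) - 2 * int i\<bar>"

text \<open>
  Unfolding the reflection at 0: the signed index \<open>y + 1 - 2 i\<close> performs a walk on the integers
  whose absolute value is the index.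
\<close>

lemma index_step_star_index:
  fixes A :: real
  assumes A: "0 \<le> A" "A \<le> 1" and i: "i \<le> y"
  defines "U \<equiv> A ^ (y + 1 - i) * (1 - A) ^ i" and "V \<equiv> A ^ i * (1 - A) ^ (y + 1 - i)"
  assumes nz: "U + V \<noteq> 0"
  shows "index_step A (star_index y i) = map_pmf (\<lambda>t. star_index (Suc y) (i + of_bool t))
    (bernoulli_pmf ((U * (1 - A) + V * A) / (U + V)))"
proof -
  define B where "B = 1 - A"
  have cancel: "(c * p * B + c * q * A) / (c * p + c * q) = (p * B + q * A) / (p + q)"
    if "c \<noteq> 0" for c p q :: real
    using that by (simp add: distrib_left[symmetric] mult.assoc)
  \<comment> \<open>The cases are the signs of \<open>y + 1 - 2 * i\<close>, and \<open>m\<close> is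
    its absolute value.\<close>
  consider (ge) m where "y + 1 = 2 * i + m" | (lt) m where "2 * i = y + 1 + m" "m > 0"
  proof (cases "y + 1 \<ge> 2 * i")
    case True
    then show ?thesis using ge[of "y + 1 - 2 * i"] by simp
  next
    case False
    then show ?thesis using lt[of "2 * i - (y + 1)"] by simp
  qed
  then show ?thesis
  proof cases
    case ge
    have U: "U = (A * B) ^ i * A ^ m" and V: "V = (A * B) ^ i * B ^ m"
      using ge by (auto simp: U_def V_def B_def[symmetric] power_mult_distrib power_add mult_2)
    have idx: "star_index y i = m"
      using ge by (auto simp: star_index_def)
    have "(A * B) ^ i \<noteq> 0"
      using nz unfolding U V by (metis add.right_neutral mult_zero_left)
    then have "(U * B + V * A) / (U + V) = (A ^ m * B + B ^ m * A) / (A ^ m + B ^ m)"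
      unfolding U V by (rule cancel)
    moreover have "(\<lambda>t. if t then nat \<bar>int m - 1\<bar> else m + 1) = (\<lambda>t. star_index (Suc y) (i + of_bool t))"
      using ge by (auto simp: star_index_def fun_eq_iff)
    ultimately show ?thesis
      by (simp add: index_step_def idx B_def)
  next
    case lt
    \<comment> \<open>Now \<open>j\<close> is the smaller exponent; extracting
      \<open>(A * B) ^ j\<close> leaves \<open>B ^ m\<close> in \<open>U\<close> and
      \<open>A ^ m\<close> in \<open>V\<close>, the reverse of the first case.\<close>
    define j where "j = y + 1 - i"
    have j: "i = j + m" "y + 1 - i = j"
      using lt i by (auto simp: j_def)
    have U: "U = (A * B) ^ j * B ^ m" and V: "V = (A * B) ^ j * A ^ m"
      unfolding U_def V_def j(2) unfolding j(1) B_def[symmetric]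
      by (auto simp: power_mult_distrib power_add)
    have idx: "star_index y i = m"
      using lt by (auto simp: star_index_def)
    have nz': "(A * B) ^ j \<noteq> 0" "A ^ m + B ^ m \<noteq> 0"
      using nz unfolding U V distrib_left[symmetric] by (auto simp: add.commute)
    from nz'(1) have "(U * B + V * A) / (U + V) = (B ^ m * B + A ^ m * A) / (B ^ m + A ^ m)"
      unfolding U V by (rule cancel)
    also have "\<dots> = 1 - (A ^ m * B + B ^ m * A) / (A ^ m + B ^ m)"
      using nz' by (simp add: B_def field_simps)
    finally have p: "(U * B + V * A) / (U + V) = 1 - (A ^ m * B + B ^ m * A) / (A ^ m + B ^ m)" .
    \<comment> \<open>At a negative signed index a further downward step enlarges the absolute
      value, so the two outcomes exchange their roles.\<close>
    have flip: "bernoulli_pmf (1 - q) = map_pmf Not (bernoulli_pmf q)" if "0 \<le> q" "q \<le> 1" for q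
    proof (rule pmf_eqI)
      fix t
      show "pmf (bernoulli_pmf (1 - q)) t = pmf (map_pmf Not (bernoulli_pmf q)) t"
        using that by (subst pmf_map_finite_support[where S = UNIV]) (cases t; auto simp: UNIV_bool)+
    qed
    have "(\<lambda>t. if t then nat \<bar>int m - 1\<bar> else m + 1) = (\<lambda>t. star_index (Suc y) (i + of_bool (\<not> t)))"
      using lt by (auto simp: star_index_def fun_eq_iff)
    moreover have "0 \<le> A ^ m" "0 \<le> B ^ m"
      using A by (auto simp: B_def)
    note weighted_mean_bounds[OF A this]
    ultimately show ?thesis
      using p flip by (simp add: index_step_def idx B_def pmf.map_comp comp_def)
  qed
qed

text \<open>Induction on \<open>y\<close>: \<open>star_index\<close> carries one transition of the
  number of ones to one transition of the index.\<close>

lemma funpow_index_step: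
  fixes A :: real
  assumes A: "0 \<le> A" "A \<le> 1"
  shows "((\<lambda>\<mu>. bind_pmf \<mu> (index_step A)) ^^ y) (return_pmf 1) =
    map_pmf (star_index y) (star_outcomes A y)"
proof (induction y)
  case 0
  show ?case by (simp add: star_outcomes_0[OF A] star_index_def)
next
  case (Suc y)
  let ?U = "\<lambda>i. A ^ (y + 1 - i) * (1 - A) ^ i" and ?V = "\<lambda>i. A ^ i * (1 - A) ^ (y + 1 - i)"
  have "((\<lambda>\<mu>. bind_pmf \<mu> (index_step A)) ^^ Suc y) (return_pmf 1)
      = bind_pmf (star_outcomes A y) (\<lambda>i. index_step A (star_index y i))"
    unfolding funpow.simps o_apply Suc.IH by (simp add: bind_map_pmf)
  also have "\<dots> = bind_pmf (star_outcomes A y) (\<lambda>i. map_pmf (\<lambda>t. star_index (Suc y) (i + of_bool t))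
      (bernoulli_pmf ((?U i * (1 - A) + ?V i * A) / (?U i + ?V i))))"
  \<comment> \<open>The transitions need to agree only on the support, where positive mass makes the
    denominator nonzero.\<close>
  proof (rule bind_pmf_cong[OF refl])
    fix i assume i: "i \<in> set_pmf (star_outcomes A y)"
    then have "i \<le> y"
      using set_star_outcomes[OF A] by auto
    moreover have "?U i + ?V i \<noteq> 0"
      using i pmf_star_outcomes[OF A \<open>i \<le> y\<close>] by (auto simp: set_pmf_iff)
    ultimately show "index_step A (star_index y i) = map_pmf (\<lambda>t. star_index (Suc y) (i + of_bool t))
        (bernoulli_pmf ((?U i * (1 - A) + ?V i * A) / (?U i + ?V i)))"
      by (rule index_step_star_index[OF A])
  qed
  also have "\<dots> = map_pmf (star_index (Suc y)) (star_outcomes A (Suc y))"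
    unfolding star_outcomes_Suc[OF A] by (simp add: map_bind_pmf pmf.map_comp comp_def)
  finally show ?case .
qed

section \<open>Measuring superpositions of two basis vectors\<close>

text \<open>For \<open>u = v = 0\<close> this is the zero vector, matching \<open>collapse\<close>
  at an outcome of probability 0; impossible outcomes thus need no separate treatment.\<close>

definition unit_cat :: "'q set \<Rightarrow> complex \<Rightarrow> complex \<Rightarrow> 'q state" where
  "unit_cat Q u v = (let n = complex_of_real (sqrt ((cmod u)\<^sup>2 + (cmod v)\<^sup>2)) in cat_state Q (u / n) (v / n))"

lemma xi_eq_unit_cat: "xi a b Q m = unit_cat Q (a ^ m) (b ^ m)"
  by (simp add: xi_def unit_cat_def norm_power power_mult[symmetric] mult.commute)

lemma pauli_X_cat_state:
  assumes "Q \<noteq> {}"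
  shows "pauli_X Q (cat_state Q u v) = cat_state Q v u"
proof
  fix A
  have "(A - Q) \<union> (Q - A) = {} \<longleftrightarrow> A = Q" "(A - Q) \<union> (Q - A) = Q \<longleftrightarrow> A = {}"
    using assms by blast+
  then show "pauli_X Q (cat_state Q u v) A = cat_state Q v u A"
    using assms by (auto simp: pauli_X_def cat_state_def)
qed

text \<open>Normalisation absorbs the modulus of \<open>c\<close>, and only its phase
  survives.\<close>

lemma unit_cat_scale:
  assumes "c \<noteq> 0"
  shows "unit_cat Q (c * u) (c * v) A = (c / cmod c) * unit_cat Q u v A"
proof -
  have "sqrt ((cmod (c * u))\<^sup>2 + (cmod (c * v))\<^sup>2) = cmod c * sqrt ((cmod u)\<^sup>2 + (cmod v)\<^sup>2)"
    by (simp add: norm_mult power_mult_distrib distrib_left[symmetric] real_sqrt_mult)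
  then show ?thesis
    by (simp add: unit_cat_def cat_state_def Let_def)
qed

lemma state_equiv_unit_cat:
  assumes "c \<noteq> 0"
  shows "state_equiv Q (unit_cat Q (c * u) (c * v)) (unit_cat Q u v)"
  using unit_cat_scale[OF assms] assms
  by (auto simp: state_equiv_def norm_divide intro!: exI[of _ "c / cmod c"])

text \<open>The bit flip on all of \<open>Q\<close> exchanges the two amplitudes; this is the
  state-level counterpart of reflecting the index at 0.\<close>

lemma state_equiv_unit_cat_flip:
  assumes "c \<noteq> 0" "Q \<noteq> {}"
  shows "state_equiv Q (unit_cat Q (c * v) (c * u)) (unit_cat Q u v)"
proof -
  have "pauli_X Q (unit_cat Q u v) = unit_cat Q v u"
    using pauli_X_cat_state[OF assms(2)] by (simp add: unit_cat_def Let_def add.commute)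
  then show ?thesis
    unfolding state_equiv_def using unit_cat_scale[OF assms(1), of Q v u] assms(1)
    by (intro exI[of _ "c / cmod c"] conjI disjI2) (simp_all add: norm_divide)
qed

lemma rename_cat_state:
  assumes "bij_betw f Q R" "Q \<noteq> {}"
  shows "rename f Q (cat_state R u v) = cat_state Q u v"
proof
  fix A
  have inj: "inj_on f Q" and R: "R = f ` Q"
    using assms(1) by (auto simp: bij_betw_def)
  have "f ` A = R \<longleftrightarrow> A = Q" if "A \<subseteq> Q"
    using that inj_on_image_eq_iff[OF inj that subset_refl] R by auto
  then show "rename f Q (cat_state R u v) A = cat_state Q u v A"
    using assms(2) by (auto simp: rename_def cat_state_def)
qed

lemma rename_unit_cat:
  assumes "bij_betw f Q R" "Q \<noteq> {}"
  shows "rename f Q (unit_cat R u v) = unit_cat Q u v"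
  using rename_cat_state[OF assms] by (simp add: unit_cat_def Let_def)

section \<open>Born weights and corrected states after a measurement\<close>

lemma pmf_embed_born:
  assumes "finite M" "(\<Sum>T\<in>Pow M. born Q M \<psi> T) = 1"
  shows "pmf (embed_pmf (born Q M \<psi>)) T = born Q M \<psi> T"
proof (rule pmf_embed_pmf)
  show nonneg: "0 \<le> born Q M \<psi> T" for T
    by (simp add: born_def sum_nonneg)
  \<comment> \<open>\<open>born\<close> vanishes outside \<open>Pow M\<close>, so the integral over
    all sets is a finite sum.\<close>
  have "(\<integral>\<^sup>+T. ennreal (born Q M \<psi> T) \<partial>count_space UNIV) = (\<Sum>T\<in>Pow M. ennreal (born Q M \<psi> T))"
    using assms(1) by (intro nn_integral_count_space') (auto simp: born_def)
  also have "\<dots> = 1"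
    using assms(2) nonneg by (simp add: sum_ennreal)
  finally show "(\<integral>\<^sup>+T. ennreal (born Q M \<psi> T) \<partial>count_space UNIV) = 1" .
qed

text \<open>The qubit \<open>z\<close> lies in \<open>R - F\<close> but not in \<open>F\<close>, so
  the two basis vectors are distinct and exactly two terms survive. The sign depending on
  \<open>s\<close> disappears in the modulus.\<close>

lemma born_two_terms:
  assumes "finite R" "Q - M = R" "T \<subseteq> M" "F \<subseteq> R - {z}" "z \<in> R"
    and amp: "\<And>B. B \<subseteq> R \<Longrightarrow> \<psi> (B \<union> T) =
      (if B = F then u else if B = R - F then (if s then - v else v) else 0) / complex_of_real (sqrt 2)"
  shows "born Q M \<psi> T = ((cmod u)\<^sup>2 + (cmod v)\<^sup>2) / 2"
proof -
  have "F \<noteq> R - F" "F \<subseteq> R"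
    using assms by auto
  have "born Q M \<psi> T = (\<Sum>B\<in>Pow R. (cmod (\<psi> (B \<union> T)))\<^sup>2)"
    using assms by (simp add: born_def)
  also have "\<dots> = (\<Sum>B\<in>Pow R. (if B = F then (cmod u)\<^sup>2 / 2 else 0)
      + (if B = R - F then (cmod v)\<^sup>2 / 2 else 0))"
    using \<open>F \<noteq> R - F\<close> by (intro sum.cong) (auto simp: amp norm_divide power_divide)
  also have "\<dots> = ((cmod u)\<^sup>2 + (cmod v)\<^sup>2) / 2"
    using \<open>F \<subseteq> R\<close> \<open>finite R\<close> by (simp add: sum.distrib add_divide_distrib)
  finally show ?thesis .
qed

text \<open>Since \<open>z\<close> separates \<open>F\<close> from its complement, the Z gate
  cancels exactly the sign of the second term. Flipping the qubits of \<open>F\<close> then sends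
  \<open>F\<close> to the empty set and \<open>R - F\<close> to \<open>R\<close>.\<close>

lemma corrected_collapse:
  assumes "finite R" "Q - M = R" "T \<subseteq> M" "F \<subseteq> R - {z}" "z \<in> R"
    and amp: "\<And>B. B \<subseteq> R \<Longrightarrow> \<psi> (B \<union> T) =
      (if B = F then u else if B = R - F then (if s then - v else v) else 0) / complex_of_real (sqrt 2)"
  shows "pauli_X F (if s then pauli_Z z (collapse Q M \<psi> T) else collapse Q M \<psi> T) = unit_cat R u v"
proof
  fix A
  define \<phi> where "\<phi> = (if s then pauli_Z z (collapse Q M \<psi> T) else collapse Q M \<psi> T)"
  define n where "n = complex_of_real (sqrt ((cmod u)\<^sup>2 + (cmod v)\<^sup>2))"
  have F: "F \<noteq> R - F" "F \<subseteq> R" "z \<notin> F" "z \<in> R - F"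
    using assms by auto
  have "born Q M \<psi> T = ((cmod u)\<^sup>2 + (cmod v)\<^sup>2) / 2"
    by (rule born_two_terms[OF assms])
  \<comment> \<open>The factor \<open>sqrt 2\<close> of the Hadamard gate cancels against the
    normalisation of the outcome.\<close>
  then have "sqrt (born Q M \<psi> T) = sqrt ((cmod u)\<^sup>2 + (cmod v)\<^sup>2) / sqrt 2"
    by (simp only: real_sqrt_divide)
  then have "collapse Q M \<psi> T B =
      (if B = F then u else if B = R - F then (if s then - v else v) else 0) / n" for B
    using F amp[of B] assms(2) by (auto simp: collapse_def n_def)
  then have \<phi>: "\<phi> B = (if B = F then u / n else if B = R - F then v / n else 0)" for B
    using F by (auto simp: \<phi>_def pauli_Z_def)
  have "(A - F) \<union> (F - A) = F \<longleftrightarrow> A = {}" "(A - F) \<union> (F - A) = R - F \<longleftrightarrow> A = R"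
    using F(2) by blast+
  then show "pauli_X F \<phi> A = unit_cat R u v A"
    by (simp add: pauli_X_def \<phi> unit_cat_def cat_state_def n_def[symmetric])
qed

text \<open>
  Common core of both swaps: once the Hadamard qubit \<open>c\<close> and the target qubits \<open>M\<close> have been
  measured, the remaining register is in a superposition of a flip pattern \<open>F T\<close> and its complement,
  and only the number of ones on \<open>M\<close> matters after the corrections.
\<close>

lemma measure_and_correct:
  fixes \<Psi> :: "'q state" and D :: "nat pmf"
  assumes fin: "finite R" "finite M" and c: "c \<notin> M" and disj: "insert c M \<inter> R = {}"
    and z: "z \<in> R" and F: "\<And>T. T \<subseteq> M \<Longrightarrow> F T \<subseteq> R - {z}"
    and amp0: "\<And>T B. T \<subseteq> M \<Longrightarrow> B \<subseteq> R \<Longrightarrow> \<Psi> (B \<union> T) = (if B = F T then u (card T) else 0)"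
    and amp1: "\<And>T B. T \<subseteq> M \<Longrightarrow> B \<subseteq> R \<Longrightarrow>
      \<Psi> (insert c (B \<union> T)) = (if B = R - F T then v (card T) else 0)"
    and D: "\<And>k. k \<le> card M \<Longrightarrow> pmf D k = (card M choose k) * ((cmod (u k))\<^sup>2 + (cmod (v k))\<^sup>2)"
    and set_D: "set_pmf D \<subseteq> {..card M}"
  shows "map_pmf (\<lambda>(T, \<phi>). (card (T - {c}),
        pauli_X (F (T - {c})) (if c \<in> T then pauli_Z z \<phi> else \<phi>)))
      (measurement (R \<union> insert c M) (insert c M) (hadamard c \<Psi>)) =
    map_pmf (\<lambda>k. (k, unit_cat R (u k) (v k))) D"
    and "set_pmf (measurement (R \<union> insert c M) (insert c M) (hadamard c \<Psi>)) \<subseteq> Pow (insert c M) \<times> UNIV"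
proof -
  let ?M = "insert c M" and ?Q = "R \<union> insert c M"
  define \<mu> where "\<mu> = embed_pmf (born ?Q ?M (hadamard c \<Psi>))"
  have Q: "?Q - ?M = R"
    using disj by auto
  \<comment> \<open>The Hadamard gate superposes the branches without and with \<open>c\<close>; the
    outcome \<open>c \<in> T\<close> supplies the minus sign.\<close>
  have amp: "hadamard c \<Psi> (B \<union> T) = (if B = F (T - {c}) then u (card (T - {c}))
      else if B = R - F (T - {c}) then (if c \<in> T then - v (card (T - {c})) else v (card (T - {c})))
      else 0) / complex_of_real (sqrt 2)" if "T \<subseteq> ?M" "B \<subseteq> R" for T B
  proof -
    let ?T = "T - {c}"
    have T: "?T \<subseteq> M" and "c \<notin> B"
      using that disj by auto
    then have "(B \<union> T) - {c} = B \<union> ?T" "insert c (B \<union> T) = insert c (B \<union> ?T)"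
      by auto
    moreover have "F ?T \<noteq> R - F ?T"
      using F[OF T] z by auto
    ultimately show ?thesis
      using amp0[OF T that(2)] amp1[OF T that(2)] \<open>c \<notin> B\<close> by (auto simp: hadamard_def)
  qed
  have F': "F (T - {c}) \<subseteq> R - {z}" if "T \<subseteq> ?M" for T
    using that by (intro F) auto
  have born: "born ?Q ?M (hadamard c \<Psi>) T =
      ((cmod (u (card (T - {c}))))\<^sup>2 + (cmod (v (card (T - {c}))))\<^sup>2) / 2" if "T \<subseteq> ?M" for T
    by (rule born_two_terms[OF fin(1) Q that F'[OF that] z amp[OF that]])
  \<comment> \<open>A general weight \<open>g\<close> serves twice: the constant 1 gives total mass
    1, and the indicator of \<open>k\<close> gives the law of the number of ones.\<close>
  have sum_g: "(\<Sum>T\<in>Pow ?M. g (card (T - {c})) * born ?Q ?M (hadamard c \<Psi>) T) =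
      (\<Sum>k\<le>card M. g k * pmf D k)" for g :: "nat \<Rightarrow> real"
  proof -
    have "(\<Sum>T\<in>Pow ?M. g (card (T - {c})) * born ?Q ?M (hadamard c \<Psi>) T) =
        (\<Sum>T\<in>Pow ?M. (\<lambda>k. g k * (((cmod (u k))\<^sup>2 + (cmod (v k))\<^sup>2) / 2)) (card (T - {c})))"
      by (intro sum.cong refl, subst born) auto
    also have "\<dots> = 2 * (\<Sum>k\<le>card M. (card M choose k) * (g k * (((cmod (u k))\<^sup>2 + (cmod (v k))\<^sup>2) / 2)))"
      by (rule sum_Pow_insert_card[OF fin(2) c])
    also have "\<dots> = (\<Sum>k\<le>card M. g k * pmf D k)"
      unfolding sum_distrib_left by (intro sum.cong) (auto simp: D)
    finally show ?thesis .
  qed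
  have "(\<Sum>T\<in>Pow ?M. born ?Q ?M (hadamard c \<Psi>) T) = 1"
    using sum_g[of "\<lambda>_. 1"] set_D by (simp add: sum_pmf_eq_1)
  then have pmf_\<mu>: "pmf \<mu> T = born ?Q ?M (hadamard c \<Psi>) T" for T
    unfolding \<mu>_def using fin(2) by (intro pmf_embed_born) auto
  then have set_\<mu>: "set_pmf \<mu> \<subseteq> Pow ?M"
    by (auto simp: set_pmf_iff born_def split: if_splits)
  then show "set_pmf (measurement ?Q ?M (hadamard c \<Psi>)) \<subseteq> Pow ?M \<times> UNIV"
    unfolding measurement_def \<mu>_def[symmetric] by auto
  have map_\<mu>: "map_pmf (\<lambda>T. card (T - {c})) \<mu> = D"
  proof (rule pmf_eqI)
    fix k
    have "pmf (map_pmf (\<lambda>T. card (T - {c})) \<mu>) k =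
        (\<Sum>T\<in>Pow ?M. if card (T - {c}) = k then pmf \<mu> T else 0)"
      using fin(2) by (intro pmf_map_finite_support set_\<mu>) simp
    also have "\<dots> =
        (\<Sum>T\<in>Pow ?M. (\<lambda>i. of_bool (i = k)) (card (T - {c})) * born ?Q ?M (hadamard c \<Psi>) T)"
      by (intro sum.cong) (simp_all add: pmf_\<mu>)
    also have "\<dots> = (\<Sum>i\<le>card M. of_bool (i = k) * pmf D i)"
      by (rule sum_g)
    also have "\<dots> = (\<Sum>i\<le>card M. if i = k then pmf D i else 0)"
      by (intro sum.cong) auto
    also have "\<dots> = pmf D k"
      using set_D by (auto simp: set_pmf_iff)
    finally show "pmf (map_pmf (\<lambda>T. card (T - {c})) \<mu>) k = pmf D k" .
  qed
  have "map_pmf (\<lambda>(T, \<phi>). (card (T - {c}), pauli_X (F (T - {c})) (if c \<in> T then pauli_Z z \<phi> else \<phi>)))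
      (measurement ?Q ?M (hadamard c \<Psi>)) =
    map_pmf (\<lambda>T. (card (T - {c}), unit_cat R (u (card (T - {c}))) (v (card (T - {c}))))) \<mu>"
    unfolding measurement_def \<mu>_def[symmetric] pmf.map_comp comp_def prod.case
  proof (rule map_pmf_cong[OF refl])
    fix T assume "T \<in> set_pmf \<mu>"
    then have T: "T \<subseteq> ?M"
      using set_\<mu> by auto
    show "(card (T - {c}), pauli_X (F (T - {c})) (if c \<in> T then pauli_Z z (collapse ?Q ?M (hadamard c \<Psi>) T)
          else collapse ?Q ?M (hadamard c \<Psi>) T)) =
        (card (T - {c}), unit_cat R (u (card (T - {c}))) (v (card (T - {c}))))"
      by (simp only: corrected_collapse[OF fin(1) Q T F'[OF T] z amp[OF T]])
  qed
  then show "map_pmf (\<lambda>(T, \<phi>). (card (T - {c}),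
        pauli_X (F (T - {c})) (if c \<in> T then pauli_Z z \<phi> else \<phi>)))
      (measurement ?Q ?M (hadamard c \<Psi>)) = map_pmf (\<lambda>k. (k, unit_cat R (u k) (v k))) D"
    unfolding map_\<mu>[symmetric] by (simp add: pmf.map_comp comp_def)
qed

section \<open>Linear swap\<close>

text \<open>Instance of \<open>measure_and_correct\<close> with Hadamard qubit \<open>j\<close>,
  single target \<open>j + 1\<close> and Z correction on \<open>j - 1\<close>. If qubit
  \<open>j\<close> is 1, the CNOT inverts the target, so outcome \<open>t = 0\<close> pairs
  \<open>\<alpha>\<close> with \<open>a\<close> and \<open>\<beta>\<close> with \<open>b\<close>,
  while \<open>t = 1\<close> pairs them crosswise.\<close>

lemma linear_swap_eq:
  fixes a b \<alpha> \<beta> :: complex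
  assumes j: "j \<ge> 2" and ab: "(cmod a)\<^sup>2 + (cmod b)\<^sup>2 = 1" and \<alpha>\<beta>: "(cmod \<alpha>)\<^sup>2 + (cmod \<beta>)\<^sup>2 = 1"
  shows "linear_swap j (m, cat_state {1..j} \<alpha> \<beta>) (1, cat_state {j + 1, j + 2} a b) =
    map_pmf (\<lambda>t. if t then (nat \<bar>int m - 1\<bar>, unit_cat {1..j} (\<alpha> * b) (\<beta> * a))
                 else (m + 1, unit_cat {1..j} (\<alpha> * a) (\<beta> * b)))
      (bernoulli_pmf ((cmod (\<alpha> * b))\<^sup>2 + (cmod (\<beta> * a))\<^sup>2))"
proof -
  define R where "R = insert (j + 2) {1..j - 1}"
  define F :: "nat set \<Rightarrow> nat set" where "F T = (if j + 1 \<in> T then {j + 2} else {})" for T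
  define u where "u k = (if k = 0 then \<alpha> * a else \<alpha> * b)" for k :: nat
  define v where "v k = (if k = 0 then \<beta> * b else \<beta> * a)" for k :: nat
  define p where "p = (cmod (\<alpha> * b))\<^sup>2 + (cmod (\<beta> * a))\<^sup>2"
  define D :: "nat pmf" where "D = map_pmf of_bool (bernoulli_pmf p)"
  define \<Psi> where "\<Psi> = cnot j (j + 1) (tensor {1..j} {j + 1, j + 2} (cat_state {1..j} \<alpha> \<beta>) (cat_state {j + 1, j + 2} a b))"
  define f where "f q = (if q = j then j + 2 else q)" for q
  define h where "h = (\<lambda>(k::nat, \<phi>). (if k = 0 then m + 1 else nat \<bar>int m - 1\<bar>, rename f {1..j} \<phi>))"
  \<comment> \<open>The four squared amplitudes are those of a product of two unit vectors.\<close>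
  have one: "p + ((cmod (\<alpha> * a))\<^sup>2 + (cmod (\<beta> * b))\<^sup>2) = 1"
  proof -
    have "p + ((cmod (\<alpha> * a))\<^sup>2 + (cmod (\<beta> * b))\<^sup>2) =
        ((cmod \<alpha>)\<^sup>2 + (cmod \<beta>)\<^sup>2) * ((cmod a)\<^sup>2 + (cmod b)\<^sup>2)"
      by (simp add: p_def norm_mult power_mult_distrib algebra_simps)
    then show ?thesis by (simp add: ab \<alpha>\<beta>)
  qed
  have p: "0 \<le> p" "p \<le> 1"
  proof -
    show "0 \<le> p"
      by (simp add: p_def)
    have "0 \<le> (cmod (\<alpha> * a))\<^sup>2 + (cmod (\<beta> * b))\<^sup>2"
      by simp
    then show "p \<le> 1"
      using one by linarith
  qed
  have Q: "{1..j + 2} = R \<union> {j, j + 1}"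
    using j by (auto simp: R_def)
  have T_cases: "T = {} \<or> T = {j + 1}" if "T \<subseteq> {j + 1}" for T
    using that by auto
  have tensor_value: "tensor {1..j} {j + 1, j + 2} (cat_state {1..j} \<alpha> \<beta>) (cat_state {j + 1, j + 2} a b) X =
      (if X \<inter> {1..j} = {} then \<alpha> else if {1..j} \<subseteq> X then \<beta> else 0) *
      (if j + 1 \<in> X then (if j + 2 \<in> X then b else 0) else (if j + 2 \<in> X then 0 else a))"
    if "X \<subseteq> {1..j + 2}" for X
  proof -
    have "X \<subseteq> {1..j} \<union> {j + 1, j + 2}"
      using that by force
    moreover have "X \<inter> {1..j} = {1..j} \<longleftrightarrow> {1..j} \<subseteq> X"
      by auto
    moreover have "X \<inter> {j + 1, j + 2} = {} \<longleftrightarrow> j + 1 \<notin> X \<and> j + 2 \<notin> X"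
      "X \<inter> {j + 1, j + 2} = {j + 1, j + 2} \<longleftrightarrow> j + 1 \<in> X \<and> j + 2 \<in> X"
      by auto
    ultimately show ?thesis
      unfolding tensor_def cat_state_def by (simp only: if_True) auto
  qed
  have amp0: "\<Psi> (B \<union> T) = (if B = F T then u (card T) else 0)" if T: "T \<subseteq> {j + 1}" and B: "B \<subseteq> R" for T B
  proof -
    have "j \<notin> B" "j + 1 \<notin> B"
      using B j by (auto simp: R_def)
    have "B \<union> T \<subseteq> {1..j + 2}"
      using B T unfolding Q by auto
    note tens = tensor_value[OF this]
    have empty: "(B \<union> T) \<inter> {1..j} = {} \<longleftrightarrow> B \<subseteq> {j + 2}"
    proof -
      have "B \<subseteq> insert (j + 2) {1..j}" "T \<inter> {1..j} = {}" "j + 2 \<notin> {1..j}"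
        using B T by (auto simp: R_def)
      then show ?thesis by blast
    qed
    have mem: "j \<notin> B \<union> T" "j + 1 \<in> B \<union> T \<longleftrightarrow> j + 1 \<in> T" "j + 2 \<in> B \<union> T \<longleftrightarrow> j + 2 \<in> B"
      using \<open>j \<notin> B\<close> \<open>j + 1 \<notin> B\<close> T by auto
    have full: "{1..j} \<subseteq> B \<union> T \<longleftrightarrow> False"
      using mem(1) j by (meson atLeastAtMost_iff one_le_numeral order.trans order_refl subsetD)
    have "\<Psi> (B \<union> T) = (if B \<subseteq> {j + 2} then \<alpha> else 0) *
        (if j + 1 \<in> T then (if j + 2 \<in> B then b else 0) else (if j + 2 \<in> B then 0 else a))"
      unfolding \<Psi>_def cnot_def if_not_P[OF mem(1)] tens unfolding empty full mem by simp
    moreover have "B = F T \<longleftrightarrow> B \<subseteq> {j + 2} \<and> (j + 2 \<in> B \<longleftrightarrow> j + 1 \<in> T)"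
      by (auto simp: F_def)
    ultimately show ?thesis
      using T_cases[OF T] by (elim disjE) (simp_all add: u_def)
  qed
  have amp1: "\<Psi> (insert j (B \<union> T)) = (if B = R - F T then v (card T) else 0)"
    if T: "T \<subseteq> {j + 1}" and B: "B \<subseteq> R" for T B
  proof -
    \<comment> \<open>\<open>X\<close> is the basis vector that the CNOT reads when qubit
      \<open>j\<close> is 1: the target bit is complemented.\<close>
    define X where "X = insert j (B \<union> ({j + 1} - T))"
    have "j \<notin> B" "j + 1 \<notin> B"
      using B j by (auto simp: R_def)
    have "X \<subseteq> {1..j + 2}"
      using B j unfolding X_def Q by auto
    note tens = tensor_value[OF this]
    have empty: "X \<inter> {1..j} = {} \<longleftrightarrow> False"
      using j by (auto simp: X_def)
    have full: "{1..j} \<subseteq> X \<longleftrightarrow> {1..j - 1} \<subseteq> B"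
    proof -
      have "{1..j} = insert j {1..j - 1}" "j \<notin> {1..j - 1}" "j + 1 \<notin> {1..j - 1}"
        using j by auto
      then show ?thesis
        unfolding X_def by blast
    qed
    have mem: "j + 1 \<in> X \<longleftrightarrow> j + 1 \<notin> T" "j + 2 \<in> X \<longleftrightarrow> j + 2 \<in> B"
      using \<open>j + 1 \<notin> B\<close> by (auto simp: X_def)
    have "\<Psi> (insert j (B \<union> T)) = tensor {1..j} {j + 1, j + 2} (cat_state {1..j} \<alpha> \<beta>) (cat_state {j + 1, j + 2} a b) X"
      unfolding \<Psi>_def cnot_def X_def using T_cases[OF T] \<open>j + 1 \<notin> B\<close>
      by (intro arg_cong[where f = "tensor _ _ _ _"]) auto
    also have "\<dots> = (if {1..j - 1} \<subseteq> B then \<beta> else 0) *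
        (if j + 1 \<in> T then (if j + 2 \<in> B then 0 else a) else (if j + 2 \<in> B then b else 0))"
      unfolding tens unfolding empty full mem by simp
    finally have "\<Psi> (insert j (B \<union> T)) = (if {1..j - 1} \<subseteq> B then \<beta> else 0) *
        (if j + 1 \<in> T then (if j + 2 \<in> B then 0 else a) else (if j + 2 \<in> B then b else 0))" .
    moreover have "B = R - F T \<longleftrightarrow> {1..j - 1} \<subseteq> B \<and> (j + 2 \<in> B \<longleftrightarrow> j + 1 \<notin> T)"
    proof -
      have "j + 2 \<notin> {1..j - 1}" by simp
      then show ?thesis
        using B unfolding F_def R_def by auto
    qed
    ultimately show ?thesis
      using T_cases[OF T] by (elim disjE) (simp_all add: v_def)
  qed
  have D: "pmf D k = (card {j + 1} choose k) * ((cmod (u k))\<^sup>2 + (cmod (v k))\<^sup>2)" if "k \<le> card {j + 1}" for k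
  proof -
    have "k = 0 \<or> k = 1"
      using that by auto
    then show ?thesis
      unfolding D_def using p one
      by (subst pmf_map_finite_support[where S = UNIV]) (auto simp: UNIV_bool u_def v_def p_def)
  qed
  have set_D: "set_pmf D \<subseteq> {..card {j + 1}}"
    by (auto simp: D_def)
  have "finite R" "finite {j + 1}" "j \<notin> {j + 1}" "insert j {j + 1} \<inter> R = {}" "j - 1 \<in> R"
    using j by (auto simp: R_def)
  moreover have "F T \<subseteq> R - {j - 1}" for T
    by (auto simp: F_def R_def)
  ultimately have meas:
    "map_pmf (\<lambda>(T, \<phi>). (card (T - {j}), pauli_X (F (T - {j})) (if j \<in> T then pauli_Z (j - 1) \<phi> else \<phi>)))
      (measurement (R \<union> {j, j + 1}) {j, j + 1} (hadamard j \<Psi>)) = map_pmf (\<lambda>k. (k, unit_cat R (u k) (v k))) D"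
    and supp: "set_pmf (measurement (R \<union> {j, j + 1}) {j, j + 1} (hadamard j \<Psi>)) \<subseteq> Pow {j, j + 1} \<times> UNIV"
    using measure_and_correct[where R = R and M = "{j + 1}" and c = j and z = "j - 1" and F = F
        and \<Psi> = \<Psi> and u = u and v = v and D = D, OF _ _ _ _ _ _ amp0 amp1 D set_D] by blast+
  have nonempty: "{1..j} \<noteq> {}"
    using j by simp
  have bij: "bij_betw f {1..j} R"
    using j by (intro bij_betwI[where g = "\<lambda>q. if q = j + 2 then j else q"])
      (auto simp: f_def R_def split: if_splits)
  have "linear_swap j (m, cat_state {1..j} \<alpha> \<beta>) (1, cat_state {j + 1, j + 2} a b) =
      map_pmf h (map_pmf (\<lambda>(T, \<phi>). (card (T - {j}), pauli_X (F (T - {j})) (if j \<in> T then pauli_Z (j - 1) \<phi> else \<phi>)))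
        (measurement (R \<union> {j, j + 1}) {j, j + 1} (hadamard j \<Psi>)))"
    unfolding linear_swap_def prod.case pmf.map_comp \<Psi>_def[symmetric] Q
  proof (rule map_pmf_cong[OF refl], clarify)
    fix T \<phi> assume "(T, \<phi>) \<in> set_pmf (measurement (R \<union> {j, j + 1}) {j, j + 1} (hadamard j \<Psi>))"
    then have "T \<subseteq> {j, j + 1}"
      using supp by auto
    then have "T - {j} = (if j + 1 \<in> T then {j + 1} else {})"
      by auto
    then have "card (T - {j}) = of_bool (j + 1 \<in> T)" "F (T - {j}) = (if j + 1 \<in> T then {j + 2} else {})"
      by (auto simp: F_def)
    then show "(if j + 1 \<in> T then nat \<bar>int m - int 1\<bar> else m + 1,
         rename (\<lambda>q. if q = j then j + 2 else q) {1..j}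
          (pauli_X (if j + 1 \<in> T then {j + 2} else {}) (if j \<in> T then pauli_Z (j - 1) \<phi> else \<phi>))) =
        (h \<circ> (\<lambda>(T, \<phi>). (card (T - {j}), pauli_X (F (T - {j})) (if j \<in> T then pauli_Z (j - 1) \<phi> else \<phi>)))) (T, \<phi>)"
      by (simp add: h_def f_def[abs_def])
  qed
  also have "\<dots> = map_pmf (\<lambda>t. h (of_bool t, unit_cat R (u (of_bool t)) (v (of_bool t)))) (bernoulli_pmf p)"
    unfolding meas D_def by (simp add: pmf.map_comp comp_def)
  also have "(\<lambda>t. h (of_bool t, unit_cat R (u (of_bool t)) (v (of_bool t)))) =
      (\<lambda>t. if t then (nat \<bar>int m - 1\<bar>, unit_cat {1..j} (\<alpha> * b) (\<beta> * a))
           else (m + 1, unit_cat {1..j} (\<alpha> * a) (\<beta> * b)))"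
    by (intro ext) (simp add: h_def rename_unit_cat[OF bij nonempty] u_def v_def del: One_nat_def)
  finally show ?thesis
    by (simp add: p_def)
qed

section \<open>The index under linear swaps as a Markov chain\<close>

lemma norm_xi_pos:
  assumes "(cmod a)\<^sup>2 + (cmod b)\<^sup>2 = 1"
  shows "cmod a ^ (2 * m) + cmod b ^ (2 * m) > 0"
proof -
  have "a \<noteq> 0 \<or> b \<noteq> 0"
    using assms by auto
  then show ?thesis
    by (auto intro: add_pos_nonneg add_nonneg_pos)
qed

text \<open>Up to the factor \<open>1 / n\<close>, outcome \<open>t = 0\<close> gives amplitudes
  \<open>a ^ (m + 1)\<close> and \<open>b ^ (m + 1)\<close>. For \<open>m > 0\<close> outcome
  \<open>t = 1\<close> gives those of index \<open>m - 1\<close> times \<open>a * b\<close>; for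
  \<open>m = 0\<close> it gives those of index 1 in exchanged order.\<close>

lemma linear_swap_xi:
  fixes a b :: complex and j m :: nat
  assumes j: "j \<ge> 2" and ab: "(cmod a)\<^sup>2 + (cmod b)\<^sup>2 = 1"
  defines "\<Xi> \<equiv> linear_swap j (m, xi a b {1..j} m) (1, cat_state {j + 1, j + 2} a b)"
  shows "map_pmf fst \<Xi> = index_step ((cmod a)\<^sup>2) m" and "values_in_xi a b {1..j} \<Xi>"
proof -
  define N where "N = cmod a ^ (2 * m) + cmod b ^ (2 * m)"
  define n where "n = complex_of_real (sqrt N)"
  have N: "N > 0"
    using norm_xi_pos[OF ab] by (simp add: N_def)
  then have n: "n \<noteq> 0" "(cmod n)\<^sup>2 = N"
    by (auto simp: n_def)
  define p where "p = (cmod (a ^ m / n * b))\<^sup>2 + (cmod (b ^ m / n * a))\<^sup>2"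
  have pow: "(cmod z ^ k)\<^sup>2 = cmod z ^ (2 * k)" for z :: complex and k
    by (simp add: power_mult[symmetric] mult.commute)
  have unit: "(cmod (a ^ m / n))\<^sup>2 + (cmod (b ^ m / n))\<^sup>2 = 1"
    using N n(2) by (simp add: norm_divide norm_power power_divide pow add_divide_distrib[symmetric] N_def)
  have \<Xi>: "\<Xi> = map_pmf (\<lambda>t. if t then (nat \<bar>int m - 1\<bar>, unit_cat {1..j} (a ^ m / n * b) (b ^ m / n * a))
                 else (m + 1, unit_cat {1..j} (a ^ m / n * a) (b ^ m / n * b))) (bernoulli_pmf p)"
    unfolding \<Xi>_def p_def linear_swap_eq[OF j ab unit, symmetric]
    by (simp add: xi_def Let_def n_def N_def)
  have "1 - (cmod a)\<^sup>2 = (cmod b)\<^sup>2"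
    using ab by simp
  then have "p = (((cmod a)\<^sup>2) ^ m * (1 - (cmod a)\<^sup>2) + (1 - (cmod a)\<^sup>2) ^ m * (cmod a)\<^sup>2) /
      (((cmod a)\<^sup>2) ^ m + (1 - (cmod a)\<^sup>2) ^ m)"
    using n(2) by (simp add: p_def norm_divide norm_mult norm_power power_divide power_mult_distrib pow
        power_mult[symmetric] mult.commute[of m 2] add_divide_distrib N_def)
  then show "map_pmf fst \<Xi> = index_step ((cmod a)\<^sup>2) m"
    unfolding \<Xi> index_step_def by (simp add: pmf.map_comp comp_def if_distrib cong: if_cong)
  have up: "state_equiv {1..j} (unit_cat {1..j} (a ^ m / n * a) (b ^ m / n * b)) (xi a b {1..j} (m + 1))"
    using state_equiv_unit_cat[of "1 / n" "{1..j}" "a ^ (m + 1)" "b ^ (m + 1)"] n(1)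
    by (simp add: xi_eq_unit_cat mult.commute)
  \<comment> \<open>The condition \<open>p \<noteq> 0\<close> makes \<open>a * b\<close> nonzero for
    \<open>m > 0\<close>; otherwise the outcome \<open>t = 1\<close> is impossible.\<close>
  have down: "state_equiv {1..j} (unit_cat {1..j} (a ^ m / n * b) (b ^ m / n * a)) (xi a b {1..j} (nat \<bar>int m - 1\<bar>))"
    if "p \<noteq> 0"
  proof (cases m)
    case 0
    then show ?thesis
      using state_equiv_unit_cat_flip[of "1 / n" "{1..j}" b a] n(1) j by (simp add: xi_eq_unit_cat)
  next
    case (Suc k)
    have "a * b / n \<noteq> 0"
      using that n(1) Suc by (auto simp: p_def)
    from state_equiv_unit_cat[OF this, of "{1..j}" "a ^ k" "b ^ k"] show ?thesis
      using Suc by (simp add: xi_eq_unit_cat mult_ac)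
  qed
  have "0 \<le> p" "p \<le> 1 \<Longrightarrow> True \<in> set_pmf (bernoulli_pmf p) \<Longrightarrow> p \<noteq> 0"
    by (auto simp: p_def set_pmf_iff)
  moreover have "p \<le> 1"
  proof -
    have "(cmod (a ^ m / n))\<^sup>2 * (cmod b)\<^sup>2 + (cmod (b ^ m / n))\<^sup>2 * (cmod a)\<^sup>2
        \<le> (cmod (a ^ m / n))\<^sup>2 * 1 + (cmod (b ^ m / n))\<^sup>2 * 1"
      using ab by (intro add_mono mult_left_mono) (auto simp: ab[symmetric])
    then show ?thesis
      using unit by (simp only: p_def norm_mult power_mult_distrib mult_1_right)
  qed
  ultimately show "values_in_xi a b {1..j} \<Xi>"
    using up down unfolding \<Xi> values_in_xi_def by (auto split: if_splits)
qed

text \<open>On the support, \<open>representative\<close> replaces each state by the standard one of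
  its index, so the next index depends on the current index alone.\<close>

lemma swap_step_index:
  fixes a b :: complex
  assumes j: "j \<ge> 2" and ab: "(cmod a)\<^sup>2 + (cmod b)\<^sup>2 = 1" and \<Xi>: "values_in_xi a b {1..j} \<Xi>"
  shows "map_pmf fst (swap_step a b j \<Xi>) = bind_pmf (map_pmf fst \<Xi>) (index_step ((cmod a)\<^sup>2))"
    and "values_in_xi a b {1..j} (swap_step a b j \<Xi>)"
proof -
  have eq: "swap_step a b j \<Xi> = bind_pmf \<Xi> (\<lambda>(m, \<psi>).
      linear_swap j (m, xi a b {1..j} m) (1, cat_state {j + 1, j + 2} a b))"
    unfolding swap_step_def
    using \<Xi> by (intro bind_pmf_cong) (auto simp: values_in_xi_def representative_def)
  show "map_pmf fst (swap_step a b j \<Xi>) = bind_pmf (map_pmf fst \<Xi>) (index_step ((cmod a)\<^sup>2))"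
    unfolding eq map_bind_pmf bind_map_pmf linear_swap_xi(1)[OF j ab, symmetric]
    by (simp add: case_prod_beta)
  show "values_in_xi a b {1..j} (swap_step a b j \<Xi>)"
    using linear_swap_xi(2)[OF j ab] unfolding eq values_in_xi_def set_bind_pmf by fastforce
qed

lemma swaps_index:
  fixes a b :: complex
  assumes "j \<ge> 2" "(cmod a)\<^sup>2 + (cmod b)\<^sup>2 = 1" "values_in_xi a b {1..j} \<Xi>"
  shows "map_pmf fst (swaps a b j x \<Xi>) =
      ((\<lambda>\<mu>. bind_pmf \<mu> (index_step ((cmod a)\<^sup>2))) ^^ x) (map_pmf fst \<Xi>)"
    and "values_in_xi a b {1..j} (swaps a b j x \<Xi>)"
proof -
  \<comment> \<open>Both claims are proved together, since the law of the next index relies on the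
    invariant \<open>values_in_xi\<close>.\<close>
  have "map_pmf fst (swaps a b j x \<Xi>) =
      ((\<lambda>\<mu>. bind_pmf \<mu> (index_step ((cmod a)\<^sup>2))) ^^ x) (map_pmf fst \<Xi>)
    \<and> values_in_xi a b {1..j} (swaps a b j x \<Xi>)"
  proof (induction x)
    case 0
    then show ?case using assms by (simp add: swaps_def)
  next
    case (Suc x)
    then show ?case
      using swap_step_index[OF assms(1,2) conjunct2[OF Suc]] by (simp add: swaps_def)
  qed
  then show "map_pmf fst (swaps a b j x \<Xi>) =
      ((\<lambda>\<mu>. bind_pmf \<mu> (index_step ((cmod a)\<^sup>2))) ^^ x) (map_pmf fst \<Xi>)"
    and "values_in_xi a b {1..j} (swaps a b j x \<Xi>)" by auto
qed

section \<open>Star swap\<close>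

text \<open>The control is never a target, so its value is unchanged throughout and the gates
  together flip all targets or none.\<close>

lemma fold_cnot:
  assumes "distinct xs" "inj_on t (set xs)" "c \<notin> t ` set xs"
  shows "fold (\<lambda>i. cnot c (t i)) xs \<psi> A =
    \<psi> (if c \<in> A then (A - t ` set xs) \<union> (t ` set xs - A) else A)"
  using assms
proof (induction xs arbitrary: \<psi> A)
  case Nil
  then show ?case by simp
next
  case (Cons x xs)
  let ?S = "t ` set xs"
  have x: "t x \<notin> ?S" "c \<notin> ?S" "c \<noteq> t x"
    using Cons.prems by auto
  have flip: "(if t x \<in> X then X - {t x} else insert (t x) X) = (A - t ` set (x # xs)) \<union> (t ` set (x # xs) - A)"
    if "X = (A - ?S) \<union> (?S - A)" for X
    using x that by auto
  have "fold (\<lambda>i. cnot c (t i)) (x # xs) \<psi> A =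
      cnot c (t x) \<psi> (if c \<in> A then (A - ?S) \<union> (?S - A) else A)"
    using Cons by simp
  also have "\<dots> = \<psi> (if c \<in> A then (A - t ` set (x # xs)) \<union> (t ` set (x # xs) - A) else A)"
    using x(2) flip[OF refl] by (auto simp: cnot_def)
  finally show ?case .
qed

text \<open>The amplitude factorises over the pairs: \<open>b\<close> if both qubits are 1,
  \<open>a\<close> if both are 0, and 0 if they differ.\<close>

lemma star_pairs_amplitude:
  fixes a b :: complex
  assumes "finite I" "S \<subseteq> I" "S' \<subseteq> I"
  defines "pair \<equiv> \<lambda>i. {Peripheral i, Central i}"
  shows "tensor_family I pair (\<lambda>i. cat_state (pair i) a b) (Peripheral ` S \<union> Central ` S') =
    (if S = S' then a ^ (card I - card S) * b ^ card S else 0)"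
proof -
  let ?A = "Peripheral ` S \<union> Central ` S'"
  have val: "cat_state (pair i) a b (?A \<inter> pair i) =
      (if i \<in> S \<and> i \<in> S' then b else if i \<notin> S \<and> i \<notin> S' then a else 0)" for i
  proof -
    have "?A \<inter> pair i = {} \<longleftrightarrow> i \<notin> S \<and> i \<notin> S'" "?A \<inter> pair i = pair i \<longleftrightarrow> i \<in> S \<and> i \<in> S'"
      by (auto simp: pair_def)
    then show ?thesis by (simp add: cat_state_def)
  qed
  have "?A \<subseteq> (\<Union>i\<in>I. pair i)"
    using assms(2,3) by (auto simp: pair_def)
  then have "tensor_family I pair (\<lambda>i. cat_state (pair i) a b) ?A =
      (\<Prod>i\<in>I. if i \<in> S \<and> i \<in> S' then b else if i \<notin> S \<and> i \<notin> S' then a else 0)"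
    by (simp add: tensor_family_def val)
  also have "\<dots> = (if S = S' then a ^ (card I - card S) * b ^ card S else 0)"
  proof (cases "S = S'")
    case True
    have "(\<Prod>i\<in>I. if i \<in> S then b else a) = (\<Prod>i\<in>S. b) * (\<Prod>i\<in>I - S. a)"
      using assms(1,2) by (subst prod.If_cases) (auto simp: Int_absorb1 Diff_eq)
    also have "\<dots> = a ^ (card I - card S) * b ^ card S"
      using assms(1,2) by (simp add: card_Diff_subset finite_subset)
    finally show ?thesis
      using True by (simp cong: if_cong)
  next
    case False
    then obtain i where "i \<in> I" "i \<in> S \<longleftrightarrow> i \<notin> S'"
      using assms(2,3) by blast
    then show ?thesis
      using False assms(1) by (auto intro!: prod_zero)
  qed
  finally show ?thesis .
qed

text \<open>Instance of \<open>measure_and_correct\<close> with Hadamard qubit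
  \<open>Central 1\<close>, the other central qubits as targets and Z correction on
  \<open>Peripheral 1\<close>. If \<open>Central 1\<close> is 0, the peripheral pattern equals the
  outcome pattern; if it is 1, the pattern is the complement in \<open>I\<close>.\<close>

lemma star_swap_eq:
  fixes a b :: complex
  assumes ab: "(cmod a)\<^sup>2 + (cmod b)\<^sup>2 = 1"
  shows "star_swap a b y = map_pmf (\<lambda>k. (star_index y k,
      unit_cat {1..y + 1} (a ^ (y + 1 - k) * b ^ k) (a ^ k * b ^ (y + 1 - k))))
    (star_outcomes ((cmod a)\<^sup>2) y)"
proof -
  define I where "I = {1..y + 1}"
  define I' where "I' = {2..y + 1}"
  define pair where "pair = (\<lambda>i. {Peripheral i, Central i})"
  define \<Psi> where "\<Psi> = tensor_family I pair (\<lambda>i. cat_state (pair i) a b)"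
  define \<Psi>' where "\<Psi>' = fold (\<lambda>i. cnot (Central 1) (Central i)) [2..<y + 2] \<Psi>"
  define R where "R = Peripheral ` I"
  define F where "F T = {Peripheral i | i. i \<in> I' \<and> Central i \<in> T}" for T
  define u where "u k = a ^ (y + 1 - k) * b ^ k" for k
  define v where "v k = a ^ k * b ^ (y + 1 - k)" for k
  define h where "h = (\<lambda>(k, \<phi>). (star_index y k, rename Peripheral I \<phi>))"
  let ?M = "Central ` I'" and ?c = "Central 1"
  have I: "I = insert 1 I'" "1 \<notin> I'" "finite I" "finite I'" "card I = y + 1" "card I' = y"
    by (auto simp: I_def I'_def)
  have M: "card ?M = y" "Central ` I = insert ?c ?M" "(\<Union>i\<in>I. pair i) = R \<union> insert ?c ?M"
    using I by (auto simp: card_image inj_on_def pair_def R_def)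
  have F_image: "F (Central ` S') = Peripheral ` S'" if "S' \<subseteq> I'" for S'
    using that by (auto simp: F_def)
  have \<Psi>': "\<Psi>' A = \<Psi> (if ?c \<in> A then (A - ?M) \<union> (?M - A) else A)" for A
  proof -
    have "set [2..<y + 2] = I'"
      by (auto simp: I'_def)
    then show ?thesis
      unfolding \<Psi>'_def using fold_cnot[of "[2..<y + 2]" Central ?c \<Psi> A] I
      by (simp add: inj_on_def image_iff)
  qed
  have amp0: "\<Psi>' (B \<union> T) = (if B = F T then u (card T) else 0)" if T: "T \<subseteq> ?M" and B: "B \<subseteq> R" for T B
  proof -
    obtain S S' where S: "B = Peripheral ` S" "S \<subseteq> I" "T = Central ` S'" "S' \<subseteq> I'"
      using T B unfolding R_def by (auto simp: subset_image_iff)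
    have "?c \<notin> B \<union> T"
      using S I by auto
    moreover have "S' \<subseteq> I"
      using S I by auto
    moreover have "B = F T \<longleftrightarrow> S = S'"
      using F_image[OF S(4)] S by (simp add: inj_image_eq_iff inj_def)
    moreover have "card T = card S'"
      using S by (simp add: card_image inj_on_def)
    ultimately show ?thesis
      using star_pairs_amplitude[OF I(3) S(2) \<open>S' \<subseteq> I\<close>, of a b] I
      by (simp add: \<Psi>' \<Psi>_def pair_def S(1,3) u_def)
  qed
  have amp1: "\<Psi>' (insert ?c (B \<union> T)) = (if B = R - F T then v (card T) else 0)"
    if T: "T \<subseteq> ?M" and B: "B \<subseteq> R" for T B
  proof -
    obtain S S' where S: "B = Peripheral ` S" "S \<subseteq> I" "T = Central ` S'" "S' \<subseteq> I'"
      using T B unfolding R_def by (auto simp: subset_image_iff)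
    \<comment> \<open>Undoing the CNOTs complements the targets while \<open>Central 1\<close> stays
      set; as \<open>1 \<notin> S'\<close>, the central pattern is \<open>I - S'\<close>.\<close>
    have "(insert ?c (B \<union> T) - ?M) \<union> (?M - insert ?c (B \<union> T)) = Peripheral ` S \<union> Central ` (I - S')"
      using S I by auto
    moreover have "B = R - F T \<longleftrightarrow> S = I - S'"
      using F_image[OF S(4)] S by (simp add: inj_image_eq_iff inj_def R_def image_set_diff[symmetric])
    moreover have "card T = card S'"
      using S by (simp add: card_image inj_on_def)
    moreover have "S' \<subseteq> I"
      using S I by auto
    then have "card (I - S') = y + 1 - card S'" "card S' \<le> y + 1"
      using I card_mono[OF I(3)] by (auto simp: card_Diff_subset finite_subset)
    ultimately show ?thesis
      using star_pairs_amplitude[OF I(3) S(2), of "I - S'" a b] I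
      by (simp add: \<Psi>' \<Psi>_def pair_def v_def)
  qed
  have A: "0 \<le> (cmod a)\<^sup>2" "(cmod a)\<^sup>2 \<le> 1" "1 - (cmod a)\<^sup>2 = (cmod b)\<^sup>2"
    using ab by (auto simp: ab[symmetric])
  have D: "pmf (star_outcomes ((cmod a)\<^sup>2) y) k = (card ?M choose k) * ((cmod (u k))\<^sup>2 + (cmod (v k))\<^sup>2)"
    if "k \<le> card ?M" for k
    using that pmf_star_outcomes[OF A(1,2), of k y] unfolding M(1) A(3)
    by (simp add: u_def v_def norm_mult norm_power power_mult_distrib power_mult[symmetric] mult.commute)
  have set_D: "set_pmf (star_outcomes ((cmod a)\<^sup>2) y) \<subseteq> {..card ?M}"
    using set_star_outcomes[OF A(1,2)] M(1) by simp
  have "finite R" "finite ?M" "?c \<notin> ?M" "insert ?c ?M \<inter> R = {}" "Peripheral 1 \<in> R"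
    using I by (auto simp: R_def)
  moreover have "F T \<subseteq> R - {Peripheral 1}" for T
    using I by (auto simp: F_def R_def)
  ultimately have meas:
    "map_pmf (\<lambda>(T, \<phi>). (card (T - {?c}), pauli_X (F (T - {?c})) (if ?c \<in> T then pauli_Z (Peripheral 1) \<phi> else \<phi>)))
      (measurement (R \<union> insert ?c ?M) (insert ?c ?M) (hadamard ?c \<Psi>')) =
      map_pmf (\<lambda>k. (k, unit_cat R (u k) (v k))) (star_outcomes ((cmod a)\<^sup>2) y)"
    and supp: "set_pmf (measurement (R \<union> insert ?c ?M) (insert ?c ?M) (hadamard ?c \<Psi>')) \<subseteq> Pow (insert ?c ?M) \<times> UNIV"
    using measure_and_correct[where R = R and M = ?M and c = ?c and z = "Peripheral 1" and F = F
        and \<Psi> = \<Psi>' and u = u and v = v and D = "star_outcomes ((cmod a)\<^sup>2) y", OF _ _ _ _ _ _ amp0 amp1 D set_D]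
    by blast+
  have "star_swap a b y = map_pmf (\<lambda>(T, \<phi>).
      (nat \<bar>int (y + 1) - 2 * int (card {i \<in> I'. Central i \<in> T})\<bar>,
       rename Peripheral I (pauli_X (F T) (if ?c \<in> T then pauli_Z (Peripheral 1) \<phi> else \<phi>))))
      (measurement (R \<union> insert ?c ?M) (insert ?c ?M) (hadamard ?c \<Psi>'))"
    unfolding M(3)[symmetric] unfolding M(2)[symmetric] unfolding star_swap_def Let_def \<Psi>'_def \<Psi>_def pair_def F_def I_def I'_def ..
  also have "\<dots> = map_pmf h (map_pmf (\<lambda>(T, \<phi>).
      (card (T - {?c}), pauli_X (F (T - {?c})) (if ?c \<in> T then pauli_Z (Peripheral 1) \<phi> else \<phi>)))
      (measurement (R \<union> insert ?c ?M) (insert ?c ?M) (hadamard ?c \<Psi>')))"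
    unfolding pmf.map_comp
  proof (rule map_pmf_cong[OF refl], clarify)
    fix T \<phi> assume "(T, \<phi>) \<in> set_pmf (measurement (R \<union> insert ?c ?M) (insert ?c ?M) (hadamard ?c \<Psi>'))"
    then have T: "T \<subseteq> insert ?c ?M"
      using supp by auto
    then have "T - {?c} = Central ` {i \<in> I'. Central i \<in> T}"
      using I by auto
    then have "card (T - {?c}) = card {i \<in> I'. Central i \<in> T}"
      by (simp add: card_image inj_on_def)
    moreover have "F (T - {?c}) = F T"
      using I by (auto simp: F_def)
    ultimately show "(nat \<bar>int (y + 1) - 2 * int (card {i \<in> I'. Central i \<in> T})\<bar>,
         rename Peripheral I (pauli_X (F T) (if ?c \<in> T then pauli_Z (Peripheral 1) \<phi> else \<phi>))) =
        (h \<circ> (\<lambda>(T, \<phi>). (card (T - {?c}), pauli_X (F (T - {?c})) (if ?c \<in> T then pauli_Z (Peripheral 1) \<phi> else \<phi>)))) (T, \<phi>)"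
      by (simp add: h_def star_index_def)
  qed
  also have "\<dots> = map_pmf (\<lambda>k. h (k, unit_cat R (u k) (v k))) (star_outcomes ((cmod a)\<^sup>2) y)"
    unfolding meas by (simp add: pmf.map_comp comp_def)
  also have "(\<lambda>k. h (k, unit_cat R (u k) (v k))) = (\<lambda>k. (star_index y k, unit_cat I (u k) (v k)))"
    using I rename_unit_cat[of Peripheral I R] by (auto simp: h_def R_def bij_betw_def inj_on_def)
  finally show ?thesis
    by (simp add: u_def v_def I_def)
qed

text \<open>The two amplitudes share a power of \<open>a * b\<close> whose exponent is the smaller
  of \<open>k\<close> and \<open>y + 1 - k\<close>. What remains is \<open>a ^ m\<close> and
  \<open>b ^ m\<close> for the index \<open>m\<close>, in exchanged order when
  \<open>2 * k > y + 1\<close>.\<close>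

lemma star_swap_index:
  fixes a b :: complex
  assumes ab: "(cmod a)\<^sup>2 + (cmod b)\<^sup>2 = 1"
  shows "map_pmf fst (star_swap a b y) = map_pmf (star_index y) (star_outcomes ((cmod a)\<^sup>2) y)"
    and "values_in_xi a b {1..y + 1} (star_swap a b y)"
proof -
  let ?Q = "{1..y + 1}" and ?D = "star_outcomes ((cmod a)\<^sup>2) y"
  show "map_pmf fst (star_swap a b y) = map_pmf (star_index y) ?D"
    unfolding star_swap_eq[OF ab] by (simp add: pmf.map_comp comp_def)
  have A: "0 \<le> (cmod a)\<^sup>2" "(cmod a)\<^sup>2 \<le> 1" "1 - (cmod a)\<^sup>2 = (cmod b)\<^sup>2"
    using ab by (auto simp: ab[symmetric])
  have "state_equiv ?Q (unit_cat ?Q (a ^ (y + 1 - k) * b ^ k) (a ^ k * b ^ (y + 1 - k))) (xi a b ?Q (star_index y k))"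
    if k: "k \<in> set_pmf ?D" for k
  proof -
    have "k \<le> y"
      using k set_star_outcomes[OF A(1,2)] by auto
    \<comment> \<open>An outcome in the support has positive weight, so the amplitudes cannot both
      vanish; hence the common factor is nonzero.\<close>
    have nz: "a ^ (y + 1 - k) * b ^ k \<noteq> 0 \<or> a ^ k * b ^ (y + 1 - k) \<noteq> 0"
    proof (rule ccontr)
      assume "\<not> ?thesis"
      then have z: "a ^ (y + 1 - k) * b ^ k = 0" "a ^ k * b ^ (y + 1 - k) = 0"
        by blast+
      have "pmf ?D k = (y choose k) *
          ((cmod (a ^ (y + 1 - k) * b ^ k))\<^sup>2 + (cmod (a ^ k * b ^ (y + 1 - k)))\<^sup>2)"
        using pmf_star_outcomes[OF A(1,2) \<open>k \<le> y\<close>] unfolding A(3)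
        by (simp add: norm_mult norm_power power_mult_distrib power_mult[symmetric] mult.commute)
      then show False
        using k unfolding z by (simp add: set_pmf_iff)
    qed
    show ?thesis
    proof (cases "2 * k \<le> y + 1")
      case True
      define m where "m = y + 1 - 2 * k"
      have m: "y + 1 - k = k + m" "star_index y k = m"
        using True by (auto simp: m_def star_index_def)
      have eq: "a ^ (y + 1 - k) * b ^ k = (a * b) ^ k * a ^ m" "a ^ k * b ^ (y + 1 - k) = (a * b) ^ k * b ^ m"
        unfolding m by (simp_all add: power_add power_mult_distrib)
      have "(a * b) ^ k \<noteq> 0"
        using nz unfolding eq by (metis mult_zero_left)
      then show ?thesis
        unfolding eq m(2) xi_eq_unit_cat by (rule state_equiv_unit_cat)
    next
      case False
      define j m where "j = y + 1 - k" and "m = 2 * k - (y + 1)"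
      have m: "y + 1 - k = j" "k = j + m" "star_index y k = m"
        using False \<open>k \<le> y\<close> by (auto simp: j_def m_def star_index_def)
      have "a ^ j * b ^ (j + m) = (a * b) ^ j * b ^ m" "a ^ (j + m) * b ^ j = (a * b) ^ j * a ^ m"
        by (simp_all add: power_add power_mult_distrib)
      then have eq: "a ^ (y + 1 - k) * b ^ k = (a * b) ^ j * b ^ m" "a ^ k * b ^ (y + 1 - k) = (a * b) ^ j * a ^ m"
        using m(1,2) by simp_all
      have "(a * b) ^ j \<noteq> 0"
        using nz unfolding eq by (metis mult_zero_left)
      then show ?thesis
        unfolding eq m(3) xi_eq_unit_cat by (rule state_equiv_unit_cat_flip) simp
    qed
  qed
  then show "values_in_xi a b ?Q (star_swap a b y)"
    unfolding star_swap_eq[OF ab] values_in_xi_def by auto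
qed

section \<open>Comparison of the star swap with \<open>y\<close> linear swaps\<close>

theorem mainTheorem7:
  fixes a b :: complex and x y :: nat
  assumes "(cmod a)\<^sup>2 + (cmod b)\<^sup>2 = 1" and "x \<ge> 1" and "y \<ge> 1"
  defines "lhs \<equiv> swaps a b (y + 1) x (star_swap a b y)"
  defines "rhs \<equiv> swaps a b (y + 1) (x + y) (return_pmf (1, cat_state {1..y + 1} a b))"
  shows "values_in_xi a b {1..y + 1} lhs \<and> values_in_xi a b {1..y + 1} rhs \<and>
         (\<forall>k. pmf (map_pmf fst lhs) k = pmf (map_pmf fst rhs) k)"
proof -
  note ab = assms(1)
  let ?K = "\<lambda>\<mu>. bind_pmf \<mu> (index_step ((cmod a)\<^sup>2))"
  have j: "y + 1 \<ge> 2"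
    using assms(3) by simp
  have "xi a b {1..y + 1} 1 = cat_state {1..y + 1} a b"
    using ab by (simp add: xi_def)
  then have init: "values_in_xi a b {1..y + 1} (return_pmf (1, cat_state {1..y + 1} a b))"
    by (auto simp: values_in_xi_def state_equiv_def intro!: exI[of _ 1])
  have A: "0 \<le> (cmod a)\<^sup>2" "(cmod a)\<^sup>2 \<le> 1"
    using ab by (auto simp: ab[symmetric])
  \<comment> \<open>The index law of the star swap is rewritten as \<open>y\<close> transitions from
    index 1, so that the further \<open>x\<close> swaps merely lengthen the same chain.\<close>
  have "map_pmf fst lhs = (?K ^^ x) ((?K ^^ y) (return_pmf 1))"
    unfolding lhs_def swaps_index(1)[OF j ab star_swap_index(2)[OF ab]] star_swap_index(1)[OF ab] funpow_index_step[OF A] ..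
  also have "\<dots> = map_pmf fst rhs"
    unfolding rhs_def swaps_index(1)[OF j ab init] by (simp add: funpow_add)
  finally show ?thesis
    unfolding lhs_def rhs_def
    using swaps_index(2)[OF j ab star_swap_index(2)[OF ab]] swaps_index(2)[OF j ab init] by simp
qed

end
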